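(* Let $n\ge3$ and let $\mathbf R^n$ have coordinates $(x_1,\dots,x_{n-1},z)$. Let $\Gamma:{]0,1]}\to\mathbf R^{n-1}=\{(x_2,\dots,x_{n-1},z)\}\subset\mathbf R^n$ be a regular embedded $C^1$ curve, whose image is also denoted $\Gamma$, such that $\Gamma$ does not meet the $z$-axis, $C:=\overline\Gamma-\Gamma$ is contained in the $z$-axis, and $\Gamma$ lies in a fixed 2-plane through the $z$-axis of the following form: there is a fixed index $j\in\{2,\dots,n-1\}$ such that for every $u$ the only coordinates of $\Gamma(u)$ that may be nonzero are $x_j(u)$ and $z(u)$. Let $\Gamma'=\Gamma|_{]0,1[}$ and let $V\subset\mathbf R^n$ be the $C^1$ surface generated by rotating $\Gamma'$ about the $z$-axis. Then $V$, with the metric induced by $\mathbf R^n$, is conformal to the punctured unit disc $\Delta^*$.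
   Context: $\Delta^*=\{w\in\mathbf C:0<|w|<1\}$. The rotation about the $z$-axis takes place in the $(x_1,x_j)$-plane: $V$ is the set of points of $\mathbf R^n$ with $x_1=x_j(u)\sin\theta$, $j$-th coordinate equal to $x_j(u)\cos\theta$, last coordinate equal to $z(u)$, and all other coordinates $0$, for $u\in{]0,1[}$ and $\theta\in[0,2\pi[$. "Conformal to $\Delta^*$" means that there is a $C^1$ diffeomorphism $\varphi:V\to\Delta^*$ under which the pullback of the Euclidean metric of $\Delta^*$ is a positive function times the metric induced by $\mathbf R^n$ on $V$. *)

theory Defs
  imports "HOL-Analysis.Analysis"
begin

text \<open>
  The coordinates of \<open>real ^ 'n\<close> are numbered by a bijection \<open>c\<close> from \<open>{1..n}\<close> to \<open>'n\<close>:
  \<open>p $ c i\<close> is the coordinate \<open>x_i\<close> of \<open>p\<close> for \<open>1 \<le> i \<le> n - 1\<close>, and \<open>p $ c n\<close> is \<open>z\<close>.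
\<close>

definition z_axis :: "nat \<Rightarrow> (nat \<Rightarrow> 'n::finite) \<Rightarrow> (real ^ 'n) set" where
  "z_axis n c = {p. \<forall>i\<in>{1..n-1}. p $ c i = 0}"

definition rotation_surface ::
    "nat \<Rightarrow> (nat \<Rightarrow> 'n::finite) \<Rightarrow> nat \<Rightarrow> (real \<Rightarrow> real ^ 'n) \<Rightarrow> (real ^ 'n) set" where
  "rotation_surface n c j \<Gamma> =
     {p. \<exists>u\<in>{0<..<1}. \<exists>\<theta>\<in>{0..<2*pi}.
           p $ c 1 = \<Gamma> u $ c j * sin \<theta> \<and>
           p $ c j = \<Gamma> u $ c j * cos \<theta> \<and>
           p $ c n = \<Gamma> u $ c n \<and>
           (\<forall>i\<in>{1..n} - {1, j, n}. p $ c i = 0)}"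

text \<open>
  Derivatives are taken within \<open>I\<close>, hence one-sided at an endpoint belonging to \<open>I\<close>;
  the library's \<open>C1_differentiable_on\<close> would require two-sided ones. An embedding is
  a homeomorphism onto its image, which is stronger than an injective immersion.
\<close>

definition regular_embedded_C1_curve_on ::
    "(real \<Rightarrow> 'a::euclidean_space) \<Rightarrow> real set \<Rightarrow> bool" where
  "regular_embedded_C1_curve_on \<Gamma> I \<longleftrightarrow>
     (\<exists>\<Gamma>'. (\<forall>u\<in>I. (\<Gamma> has_vector_derivative \<Gamma>' u) (at u within I) \<and> \<Gamma>' u \<noteq> 0) \<and>
           continuous_on I \<Gamma>') \<and>
     (\<exists>g. homeomorphism I (\<Gamma> ` I) \<Gamma> g)"

text \<open>
  A map on an arbitrary subset \<open>X\<close> of a Euclidean space is \<open>C\<^sup>1\<close> if near every point of \<open>X\<close>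
  it is the restriction of a \<open>C\<^sup>1\<close> map defined on an open set of the ambient space. A set that
  is \<open>C\<^sup>1\<close> diffeomorphic in this sense to an open subset of the plane is an embedded \<open>C\<^sup>1\<close> surface.
\<close>

definition C1_map_on :: "('a::euclidean_space \<Rightarrow> 'b::euclidean_space) \<Rightarrow> 'a set \<Rightarrow> bool" where
  "C1_map_on f X \<longleftrightarrow>
     (\<forall>x\<in>X. \<exists>U g (g' :: 'a \<Rightarrow> 'a \<Rightarrow>\<^sub>L 'b). open U \<and> x \<in> U \<and>
        (\<forall>y\<in>U. (g has_derivative blinfun_apply (g' y)) (at y)) \<and> continuous_on U g' \<and>
        (\<forall>y\<in>U \<inter> X. f y = g y))"

definition C1_diffeomorphism ::
    "('a::euclidean_space \<Rightarrow> 'b::euclidean_space) \<Rightarrow> 'a set \<Rightarrow> 'b set \<Rightarrow> bool" where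
  "C1_diffeomorphism f X Y \<longleftrightarrow>
     bij_betw f X Y \<and> C1_map_on f X \<and> C1_map_on (inv_into X f) Y"

definition tangent_vectors :: "'a::euclidean_space set \<Rightarrow> 'a \<Rightarrow> 'a set" where
  "tangent_vectors X p =
     {v. \<exists>\<epsilon>>0. \<exists>\<gamma>. \<gamma> C1_differentiable_on {-\<epsilon><..<\<epsilon>} \<and> \<gamma> ` {-\<epsilon><..<\<epsilon>} \<subseteq> X \<and>
           \<gamma> 0 = p \<and> (\<gamma> has_vector_derivative v) (at 0)}"

text \<open>
  The differential of \<open>\<phi>\<close> at \<open>p\<close> is the restriction of \<open>D\<close> to the tangent vectors. That restriction
  is determined by \<open>\<phi>\<close> on \<open>X\<close> (chain rule along curves in \<open>X\<close>), although \<open>D\<close> itself need not be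
  unique. The metrics on \<open>X\<close> and \<open>Y\<close> are those induced by the ambient inner products.
\<close>

definition conformal_to :: "'a::euclidean_space set \<Rightarrow> 'b::euclidean_space set \<Rightarrow> bool" where
  "conformal_to X Y \<longleftrightarrow>
     (\<exists>\<phi> \<mu>. C1_diffeomorphism \<phi> X Y \<and>
        (\<forall>p\<in>X. \<mu> p > (0::real) \<and>
           (\<exists>D. (\<phi> has_derivative D) (at p within X) \<and>
                (\<forall>v\<in>tangent_vectors X p. \<forall>w\<in>tangent_vectors X p.
                    D v \<bullet> D w = \<mu> p * (v \<bullet> w)))))"

definition punctured_unit_disc :: "complex set" where
  "punctured_unit_disc = {w. 0 < norm w \<and> norm w < 1}"

end

theory Submission
  imports Defs
begin

text \<open>
  Write \<open>r\<close> for the distance of \<open>\<Gamma>\<close> from the axis. The induced metric is \<open>|\<Gamma>'|\<^sup>2 du\<^sup>2 + r\<^sup>2 d\<theta>\<^sup>2\<close>,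
  which equals \<open>r\<^sup>2 (dt\<^sup>2 + d\<theta>\<^sup>2)\<close> for \<open>t(u) = \<integral>\<^sub>u\<^sup>1 |\<Gamma>'| / r\<close>, so \<open>(u, \<theta>) \<mapsto> exp (- t(u) + i \<theta>)\<close> is conformal.
  Its image is the whole punctured disc because \<open>t\<close> is unbounded near \<open>0\<close>: \<open>t\<close> is the length of \<open>\<Gamma>\<close>
  in the hyperbolic half-plane \<open>r > 0\<close>, and by completeness finite length would give a limit of
  \<open>\<Gamma>\<close> off the axis, necessarily a point of \<open>\<Gamma>\<close>, which embeddedness forbids.
\<close>

section \<open>Calculus of C1 maps on arbitrary subsets\<close>

text \<open>In finite dimension a family of linear maps is continuous in operator norm as soon as
  its value at each vector is, so the derivative of an extension can be checked one direction at a
  time.\<close>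

lemma C1_map_onI:
  fixes f :: "'a::euclidean_space \<Rightarrow> 'b::euclidean_space"
  assumes "\<And>x. x \<in> X \<Longrightarrow> \<exists>U g G. open U \<and> x \<in> U \<and> (\<forall>y\<in>U. (g has_derivative G y) (at y)) \<and>
             (\<forall>v. continuous_on U (\<lambda>y. G y v)) \<and> (\<forall>y\<in>U \<inter> X. f y = g y)"
  shows "C1_map_on f X"
  unfolding C1_map_on_def
proof
  fix x assume "x \<in> X"
  then obtain U g G where U: "open U" "x \<in> U"
    and g: "\<And>y. y \<in> U \<Longrightarrow> (g has_derivative G y) (at y)"
    and G: "\<And>v. continuous_on U (\<lambda>y. G y v)"
    and eq: "\<forall>y\<in>U \<inter> X. f y = g y"
    using assms[of x] by metis
  have Blinfun: "blinfun_apply (Blinfun (G y)) = G y" if "y \<in> U" for y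
    using g[OF that] by (simp add: bounded_linear_Blinfun_apply has_derivative_bounded_linear)
  have "continuous_on U (\<lambda>y. Blinfun (G y))"
  proof (rule continuous_on_blinfun_componentwise)
    fix i :: 'a
    show "continuous_on U (\<lambda>y. blinfun_apply (Blinfun (G y)) i)"
      using G[of i] by (simp add: Blinfun cong: continuous_on_cong)
  qed
  then show "\<exists>U g (g' :: 'a \<Rightarrow> 'a \<Rightarrow>\<^sub>L 'b). open U \<and> x \<in> U \<and>
      (\<forall>y\<in>U. (g has_derivative blinfun_apply (g' y)) (at y)) \<and> continuous_on U g' \<and>
      (\<forall>y\<in>U \<inter> X. f y = g y)"
    using U g eq Blinfun by (intro exI[of _ U] exI[of _ g] exI[of _ "\<lambda>y. Blinfun (G y)"]) simp
qed

lemma C1_map_on_obtain: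
  fixes f :: "'a::euclidean_space \<Rightarrow> 'b::euclidean_space"
  assumes "C1_map_on f X" "x \<in> X"
  obtains U g and g' :: "'a \<Rightarrow> 'a \<Rightarrow>\<^sub>L 'b" where "open U" "x \<in> U"
    "\<forall>y\<in>U. (g has_derivative blinfun_apply (g' y)) (at y)"
    "continuous_on U g'" "continuous_on U g" "\<forall>y\<in>U \<inter> X. f y = g y"
proof -
  from bspec[OF assms(1)[unfolded C1_map_on_def] assms(2)] show thesis
  proof (elim exE conjE)
    fix U g and g' :: "'a \<Rightarrow> 'a \<Rightarrow>\<^sub>L 'b"
    assume *: "open U" "x \<in> U" "\<forall>y\<in>U. (g has_derivative blinfun_apply (g' y)) (at y)"
      "continuous_on U g'" "\<forall>y\<in>U \<inter> X. f y = g y"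
    have "continuous_on U g"
      using *(3) by (intro continuous_at_imp_continuous_on) (auto dest: has_derivative_continuous)
    from that[OF *(1-4) this *(5)] show thesis .
  qed
qed

lemma C1_map_on_compose:
  fixes f :: "'a::euclidean_space \<Rightarrow> 'b::euclidean_space" and h :: "'b \<Rightarrow> 'c::euclidean_space"
  assumes f: "C1_map_on f X" and h: "C1_map_on h Y" and sub: "f ` X \<subseteq> Y"
  shows "C1_map_on (\<lambda>x. h (f x)) X"
proof (rule C1_map_onI)
  fix x assume x: "x \<in> X"
  obtain U g and g' :: "'a \<Rightarrow> 'a \<Rightarrow>\<^sub>L 'b" where U: "open U" "x \<in> U"
    and g: "\<forall>y\<in>U. (g has_derivative blinfun_apply (g' y)) (at y)"
    and cont: "continuous_on U g'" "continuous_on U g"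
    and fg: "\<forall>y\<in>U \<inter> X. f y = g y"
    by (rule C1_map_on_obtain[OF f x])
  obtain W k and k' :: "'b \<Rightarrow> 'b \<Rightarrow>\<^sub>L 'c" where W: "open W" "f x \<in> W"
    and k: "\<forall>y\<in>W. (k has_derivative blinfun_apply (k' y)) (at y)"
    and contk: "continuous_on W k'"
    and hk: "\<forall>y\<in>W \<inter> Y. h y = k y"
  proof -
    have "f x \<in> Y" using sub x by blast
    show thesis by (rule C1_map_on_obtain[OF h \<open>f x \<in> Y\<close>]) (rule that)
  qed
  \<comment> \<open>The extension \<open>k\<close> is differentiable only on \<open>W\<close>, so
    the neighbourhood of \<open>x\<close> shrinks to the points that \<open>g\<close> sends there;
    off \<open>X\<close> the values of \<open>g\<close> may lie outside \<open>Y\<close>.\<close>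
  let ?V = "U \<inter> g -` W"
  have "open ?V" using cont(2) U(1) W(1) by (simp add: continuous_open_preimage)
  moreover have "x \<in> ?V" using U W fg x by auto
  moreover have "((\<lambda>y. k (g y)) has_derivative (\<lambda>v. k' (g y) (g' y v))) (at y)" if "y \<in> ?V" for y
    using that by (intro has_derivative_compose[OF g[rule_format] k[rule_format]]) auto
  moreover have "continuous_on ?V (\<lambda>y. k' (g y) (g' y v))" for v
  proof -
    have "continuous_on ?V g" "continuous_on ?V g'"
      by (rule continuous_on_subset[OF cont(2)] continuous_on_subset[OF cont(1)], blast)+
    moreover from this have "continuous_on ?V (\<lambda>y. k' (g y))"
      by (intro continuous_on_compose2[OF contk]) auto
    ultimately show ?thesis by (intro blinfun.continuous_on continuous_on_const)
  qed
  moreover have "\<forall>y\<in>?V \<inter> X. h (f y) = k (g y)" using fg hk sub by force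
  ultimately show "\<exists>U g G. open U \<and> x \<in> U \<and> (\<forall>y\<in>U. (g has_derivative G y) (at y)) \<and>
      (\<forall>v. continuous_on U (\<lambda>y. G y v)) \<and> (\<forall>y\<in>U \<inter> X. h (f y) = g y)"
    by (intro exI[of _ ?V] exI[of _ "\<lambda>y. k (g y)"] exI[of _ "\<lambda>y v. k' (g y) (g' y v)"]) simp
qed

lemma C1_map_on_open:
  fixes f :: "'a::euclidean_space \<Rightarrow> 'b::euclidean_space"
  assumes "open S" "X \<subseteq> S" "\<And>x. x \<in> S \<Longrightarrow> (f has_derivative f' x) (at x)"
    "\<And>v. continuous_on S (\<lambda>x. f' x v)"
  shows "C1_map_on f X"
  using assms by (intro C1_map_onI exI[of _ S] exI[of _ f] exI[of _ f']) auto

lemma C1_map_on_bounded_linear: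
  fixes f :: "'a::euclidean_space \<Rightarrow> 'b::euclidean_space"
  assumes "bounded_linear f"
  shows "C1_map_on f X"
  using assms
  by (intro C1_map_on_open[where S = UNIV and f' = "\<lambda>_. f"])
     (auto intro: bounded_linear_imp_has_derivative)

lemma C1_map_on_real:
  fixes f f' :: "real \<Rightarrow> real"
  assumes "open S" "\<And>x. x \<in> S \<Longrightarrow> (f has_real_derivative f' x) (at x)" "continuous_on S f'"
  shows "C1_map_on f S"
  using assms
  by (intro C1_map_on_open[where S = S and f' = "\<lambda>x v. f' x * v"])
     (auto simp: has_field_derivative_def intro!: continuous_intros)

lemma C1_map_on_norm:
  fixes X :: "'a::euclidean_space set"
  assumes "0 \<notin> X"
  shows "C1_map_on norm X"
  using assms
  by (intro C1_map_on_open[where S = "- {0}" and f' = "\<lambda>x v. v \<bullet> sgn x"])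
     (auto intro!: has_derivative_norm continuous_on_inner continuous_on_sgn
        continuous_on_const continuous_on_id)

lemma C1_map_on_Pair:
  fixes f :: "'a::euclidean_space \<Rightarrow> 'b::euclidean_space" and h :: "'a \<Rightarrow> 'c::euclidean_space"
  assumes f: "C1_map_on f X" and h: "C1_map_on h X"
  shows "C1_map_on (\<lambda>x. (f x, h x)) X"
proof (rule C1_map_onI)
  fix x assume x: "x \<in> X"
  obtain U g and g' :: "'a \<Rightarrow> 'a \<Rightarrow>\<^sub>L 'b" where g: "open U" "x \<in> U"
     "\<forall>y\<in>U. (g has_derivative blinfun_apply (g' y)) (at y)"
     "continuous_on U g'" "\<forall>y\<in>U \<inter> X. f y = g y"
    by (rule C1_map_on_obtain[OF f x])
  obtain W k and k' :: "'a \<Rightarrow> 'a \<Rightarrow>\<^sub>L 'c" where k: "open W" "x \<in> W"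
     "\<forall>y\<in>W. (k has_derivative blinfun_apply (k' y)) (at y)"
     "continuous_on W k'" "\<forall>y\<in>W \<inter> X. h y = k y"
    by (rule C1_map_on_obtain[OF h x])
  have "continuous_on (U \<inter> W) (\<lambda>y. (g' y v, k' y v))" for v
    by (intro continuous_intros continuous_on_subset[OF g(4)] continuous_on_subset[OF k(4)]) auto
  then show "\<exists>U g G. open U \<and> x \<in> U \<and> (\<forall>y\<in>U. (g has_derivative G y) (at y)) \<and>
      (\<forall>v. continuous_on U (\<lambda>y. G y v)) \<and> (\<forall>y\<in>U \<inter> X. (f y, h y) = g y)"
    using g k by (intro exI[of _ "U \<inter> W"] exI[of _ "\<lambda>y. (g y, k y)"]
      exI[of _ "\<lambda>y v. (g' y v, k' y v)"]) (auto intro!: has_derivative_Pair)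
qed

lemma C1_map_on_scaleR:
  fixes f :: "'a::euclidean_space \<Rightarrow> real" and h :: "'a \<Rightarrow> 'b::euclidean_space"
  assumes "C1_map_on f X" "C1_map_on h X"
  shows "C1_map_on (\<lambda>x. f x *\<^sub>R h x) X"
proof -
  have "C1_map_on (\<lambda>p :: real \<times> 'b. fst p *\<^sub>R snd p) UNIV"
    by (rule C1_map_on_open[where S = UNIV and f' = "\<lambda>p v. fst p *\<^sub>R snd v + fst v *\<^sub>R snd p"])
       (auto intro!: derivative_eq_intros continuous_intros)
  from C1_map_on_compose[OF C1_map_on_Pair[OF assms] this] show ?thesis by simp
qed

lemma C1_map_on_cong:
  assumes "C1_map_on f X" "\<And>x. x \<in> X \<Longrightarrow> f x = g x"
  shows "C1_map_on g X"
  using assms unfolding C1_map_on_def by (metis IntD2)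

lemma C1_map_on_has_derivative:
  assumes "C1_map_on f X" "x \<in> X"
  obtains D where "(f has_derivative D) (at x within X)"
proof -
  obtain U g g' where *: "open U" "x \<in> U"
    "\<forall>y\<in>U. (g has_derivative blinfun_apply (g' y)) (at y)"
    "\<forall>y\<in>U \<inter> X. f y = g y"
    by (rule C1_map_on_obtain[OF assms])
  have "(g has_derivative blinfun_apply (g' x)) (at x within U \<inter> X)"
    using *(2,3) has_derivative_at_withinI by blast
  then have "(f has_derivative blinfun_apply (g' x)) (at x within U \<inter> X)"
    by (rule has_derivative_transform[rotated 2]) (use *(2,4) assms(2) in auto)
  moreover have "at x within U \<inter> X = at x within X"
    using *(1,2) by (intro at_within_nhd[of x U]) auto
  ultimately show thesis using that by simp
qed

section \<open>Inverses of real functions and of embedded curves\<close>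

text \<open>Injectivity holds on all of \<open>S\<close>, so invariance of domain gives an open
  image and a continuous inverse at once; the one-variable derivative rule for inverses then applies
  pointwise.\<close>

lemma C1_inverse_real:
  fixes f f' :: "real \<Rightarrow> real"
  assumes S: "open S" and f: "\<And>u. u \<in> S \<Longrightarrow> (f has_real_derivative f' u) (at u)"
    and f'0: "\<And>u. u \<in> S \<Longrightarrow> f' u \<noteq> 0" and f': "continuous_on S f'" and inj: "inj_on f S"
  obtains k where "open (f ` S)" "\<forall>u\<in>S. k (f u) = u"
    "\<forall>y\<in>f ` S. (k has_real_derivative inverse (f' (k y))) (at y)"
    "continuous_on (f ` S) (\<lambda>y. inverse (f' (k y)))"
proof -
  have cont: "continuous_on S f" using f by (meson DERIV_isCont continuous_at_imp_continuous_on)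
  obtain k where k: "homeomorphism S (f ` S) f k"
    using invariance_of_domain_homeomorphism[OF S cont] inj by auto
  have open_im: "open (f ` S)" by (rule invariance_of_domain[OF cont S inj])
  have kS: "k y \<in> S" "f (k y) = y" if "y \<in> f ` S" for y
    using that k by (auto simp: homeomorphism_def)
  have contk: "continuous_on (f ` S) k" using k by (simp add: homeomorphism_def)
  have "(k has_real_derivative inverse (f' (k y))) (at y)" if y: "y \<in> f ` S" for y
  proof -
    obtain e where e: "e > 0" "ball y e \<subseteq> f ` S" using open_im y openE by blast
    have *: "f (k x) = x" if "y - e < x" "x < y + e" for x
      using kS(2)[of x] e that by (auto simp: dist_real_def subset_iff)
    show ?thesis
      by (rule DERIV_inverse_function[of f _ k y "y - e" "y + e"])
         (use * f[OF kS(1)[OF y]] f'0[OF kS(1)[OF y]] e contk open_im y in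
           \<open>auto simp: continuous_on_eq_continuous_at\<close>)
  qed
  moreover have "continuous_on (f ` S) (\<lambda>y. inverse (f' (k y)))"
    using kS f'0 by (intro continuous_on_inverse continuous_on_compose2[OF f' contk]) auto
  moreover have "k (f u) = u" if "u \<in> S" for u
    using that k by (simp add: homeomorphism_def)
  ultimately show thesis by (intro that[OF open_im]) simp_all
qed

text \<open>Near \<open>\<Gamma> u0\<close> the parameter can be read off from the component along
  the velocity \<open>d\<close> at \<open>u0\<close>, because that component has positive derivative
  there. Composing the real inverse with the projection extends \<open>g\<close> to an ambient open
  set.\<close>

lemma C1_map_on_inverse_curve:
  fixes \<Gamma> \<Gamma>' :: "real \<Rightarrow> 'a::euclidean_space"
  assumes S: "open S" and \<Gamma>: "\<And>u. u \<in> S \<Longrightarrow> (\<Gamma> has_vector_derivative \<Gamma>' u) (at u)"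
    and \<Gamma>'0: "\<And>u. u \<in> S \<Longrightarrow> \<Gamma>' u \<noteq> 0" and \<Gamma>': "continuous_on S \<Gamma>'"
    and hom: "homeomorphism S (\<Gamma> ` S) \<Gamma> g"
  shows "C1_map_on g (\<Gamma> ` S)"
proof (rule C1_map_onI)
  fix x assume "x \<in> \<Gamma> ` S"
  then obtain u0 where u0: "u0 \<in> S" "x = \<Gamma> u0" by blast
  define d where "d = \<Gamma>' u0"
  define f where "f = (\<lambda>u. \<Gamma> u \<bullet> d)"
  define f' where "f' = (\<lambda>u. \<Gamma>' u \<bullet> d)"
  have df: "(f has_real_derivative f' u) (at u)" if "u \<in> S" for u
    using \<Gamma>[OF that] unfolding f_def f'_def has_vector_derivative_def has_field_derivative_def
    by (auto intro!: derivative_eq_intros)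
  have contf': "continuous_on S f'" unfolding f'_def by (intro continuous_intros \<Gamma>')
  have "open (S \<inter> f' -` {0<..})" by (rule continuous_open_preimage[OF contf' S]) simp
  moreover have "u0 \<in> S \<inter> f' -` {0<..}" using u0 \<Gamma>'0[of u0] by (simp add: f'_def d_def)
  ultimately obtain e where e: "e > 0" "ball u0 e \<subseteq> S \<inter> f' -` {0<..}" using openE by blast
  define B where "B = ball u0 e"
  have BS: "u \<in> S" "f' u > 0" if "u \<in> B" for u using e(2) that by (auto simp: B_def)
  have "f u < f v" if uv: "u \<in> B" "v \<in> B" "u < v" for u v
  proof (rule DERIV_pos_imp_increasing[OF uv(3)])
    fix w assume "u \<le> w" "w \<le> v"
    then have "w \<in> B" using uv by (auto simp: B_def dist_real_def)
    then show "\<exists>y. (f has_real_derivative y) (at w) \<and> y > 0" using df BS by blast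
  qed
  then have inj: "inj_on f B" by (intro linorder_inj_onI) force+
  have contB: "continuous_on B f'" using BS by (intro continuous_on_subset[OF contf']) auto
  have B: "open B" "\<And>u. u \<in> B \<Longrightarrow> f' u \<noteq> 0" using BS(2) by (force simp: B_def)+
  obtain k where k: "open (f ` B)" "\<forall>u\<in>B. k (f u) = u"
    "\<forall>y\<in>f ` B. (k has_real_derivative inverse (f' (k y))) (at y)"
    "continuous_on (f ` B) (\<lambda>y. inverse (f' (k y)))"
    by (rule C1_inverse_real[OF B(1) df[OF BS(1)] B(2) contB inj])
  have "continuous_on (\<Gamma> ` S) g" using hom by (simp add: homeomorphism_def)
  \<comment> \<open>Continuity of \<open>g\<close> gives an ambient open set that meets the curve
    exactly in the points with parameter in \<open>B\<close>. It excludes distant pieces of the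
    curve with the same values of \<open>q \<bullet> d\<close>.\<close>
  then obtain A where A: "open A" "A \<inter> \<Gamma> ` S = g -` B \<inter> \<Gamma> ` S"
    unfolding continuous_on_open_invariant by (auto simp: B_def)
  have gu: "g (\<Gamma> u) = u" if "u \<in> S" for u using hom that by (simp add: homeomorphism_def)
  let ?U = "A \<inter> (\<lambda>q. q \<bullet> d) -` (f ` B)"
  have "open ?U" using A(1) k(1) by (intro open_Int open_vimage continuous_intros)
  moreover have "x \<in> ?U"
  proof -
    have "u0 \<in> B" using e by (simp add: B_def)
    then have "x \<in> A" using A(2) u0 gu by fastforce
    then show ?thesis using \<open>u0 \<in> B\<close> u0 by (auto simp: f_def)
  qed
  moreover have "((\<lambda>q. k (q \<bullet> d)) has_derivative (\<lambda>v. inverse (f' (k (q \<bullet> d))) * (v \<bullet> d))) (at q)"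
    if "q \<in> ?U" for q
    by (rule has_derivative_compose[where f = "\<lambda>q. q \<bullet> d"])
       (use that k(3) in \<open>auto simp: has_field_derivative_def
          intro: bounded_linear_imp_has_derivative bounded_linear_inner_left\<close>)
  moreover have "continuous_on ?U (\<lambda>q. inverse (f' (k (q \<bullet> d))) * (v \<bullet> d))" for v
    by (intro continuous_on_mult continuous_on_const
          continuous_on_compose2[OF k(4), where f = "\<lambda>q. q \<bullet> d"] continuous_intros) auto
  moreover have "\<forall>q\<in>?U \<inter> \<Gamma> ` S. g q = k (q \<bullet> d)"
  proof
    fix q assume q: "q \<in> ?U \<inter> \<Gamma> ` S"
    then obtain u where u: "u \<in> S" "q = \<Gamma> u" by blast
    have "u \<in> B" using q A(2) u gu by fastforce
    then show "g q = k (q \<bullet> d)" using k(2) u gu by (simp add: f_def)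
  qed
  ultimately show "\<exists>U k K. open U \<and> x \<in> U \<and> (\<forall>y\<in>U. (k has_derivative K y) (at y)) \<and>
      (\<forall>v. continuous_on U (\<lambda>y. K y v)) \<and> (\<forall>y\<in>U \<inter> \<Gamma> ` S. g y = k y)"
    by (intro exI[of _ ?U] exI[of _ "\<lambda>q. k (q \<bullet> d)"]
        exI[of _ "\<lambda>q v. inverse (f' (k (q \<bullet> d))) * (v \<bullet> d)"]) simp
qed

section \<open>Conformality read off from the inverse map\<close>

text \<open>
  A curve \<open>\<gamma>\<close> in \<open>X\<close> equals \<open>\<psi> \<circ> (\<phi> \<circ> \<gamma>)\<close>, so \<open>d\<psi>\<close> inverts \<open>d\<phi>\<close> on tangent vectors, and it suffices
  to compute with \<open>\<psi>\<close>, whose domain is usually open.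
\<close>

lemma conformal_toI:
  fixes \<phi> :: "'a::euclidean_space \<Rightarrow> 'b::euclidean_space"
  assumes C1: "C1_map_on \<phi> X" "C1_map_on \<psi> Y"
    and maps: "\<And>p. p \<in> X \<Longrightarrow> \<phi> p \<in> Y" "\<And>q. q \<in> Y \<Longrightarrow> \<psi> q \<in> X"
    and inv: "\<And>p. p \<in> X \<Longrightarrow> \<psi> (\<phi> p) = p" "\<And>q. q \<in> Y \<Longrightarrow> \<phi> (\<psi> q) = q"
    and conf: "\<And>q. q \<in> Y \<Longrightarrow> \<exists>\<Psi> \<mu>. (\<psi> has_derivative \<Psi>) (at q within Y) \<and> \<mu> > 0 \<and>
        (\<forall>a b. \<Psi> a \<bullet> \<Psi> b = \<mu> * (a \<bullet> b))"
  shows "conformal_to X Y"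
proof -
  have bij: "bij_betw \<phi> X Y"
    by (rule bij_betw_byWitness[where f' = \<psi>]) (use maps inv in auto)
  have "inv_into X \<phi> q = \<psi> q" if "q \<in> Y" for q
    using bij inv maps that by (metis bij_betw_inv_into_left)
  then have "C1_map_on (inv_into X \<phi>) Y" using C1_map_on_cong[OF C1(2)] by simp
  then have diffeo: "C1_diffeomorphism \<phi> X Y" using bij C1 by (simp add: C1_diffeomorphism_def)
  have "\<exists>\<mu>>0. \<exists>D. (\<phi> has_derivative D) (at p within X) \<and>
      (\<forall>v\<in>tangent_vectors X p. \<forall>w\<in>tangent_vectors X p. D v \<bullet> D w = \<mu> * (v \<bullet> w))"
    if p: "p \<in> X" for p
  proof -
    obtain \<Psi> \<mu> where \<Psi>: "(\<psi> has_derivative \<Psi>) (at (\<phi> p) within Y)" and \<mu>: "\<mu> > 0"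
      and inner: "\<And>a b. \<Psi> a \<bullet> \<Psi> b = \<mu> * (a \<bullet> b)"
      using conf[OF maps(1)[OF p]] by blast
    obtain D where D: "(\<phi> has_derivative D) (at p within X)"
      using C1_map_on_has_derivative[OF C1(1) p] by blast
    have \<Psi>D: "\<Psi> (D v) = v" if v: "v \<in> tangent_vectors X p" for v
    proof -
      obtain e \<gamma> where e: "e > 0" and \<gamma>: "\<gamma> ` {-e<..<e} \<subseteq> X" "\<gamma> 0 = p"
        "(\<gamma> has_vector_derivative v) (at 0)"
        using v unfolding tangent_vectors_def by blast
      \<comment> \<open>\<open>\<phi>\<close> and \<open>\<psi>\<close> are differentiable only
        within \<open>X\<close> and \<open>Y\<close>, so the chain rule runs within the interval on
        which \<open>\<gamma>\<close> stays in \<open>X\<close>; at its interior point 0 this yields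
        the ordinary derivative.\<close>
      have at0: "at 0 within {-e<..<e} = at (0::real)"
        using e by (intro at_within_open) auto
      have 1: "(\<gamma> has_derivative (\<lambda>h. h *\<^sub>R v)) (at 0 within {-e<..<e})"
        using \<gamma>(3) by (simp add: has_vector_derivative_def at0)
      have 2: "((\<lambda>h. \<phi> (\<gamma> h)) has_derivative (\<lambda>h. D (h *\<^sub>R v))) (at 0 within {-e<..<e})"
        using D \<gamma> by (intro has_derivative_in_compose[OF 1]) (auto intro: has_derivative_subset)
      have sub: "(\<lambda>h. \<phi> (\<gamma> h)) ` {-e<..<e} \<subseteq> Y" using \<gamma>(1) maps(1) by blast
      have "((\<lambda>h. \<psi> (\<phi> (\<gamma> h))) has_derivative (\<lambda>h. \<Psi> (D (h *\<^sub>R v))))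
          (at 0 within {-e<..<e})"
        using has_derivative_subset[OF \<Psi> sub] \<gamma>(2)
        by (intro has_derivative_in_compose[OF 2]) simp
      then have "(\<gamma> has_derivative (\<lambda>h. \<Psi> (D (h *\<^sub>R v)))) (at 0 within {-e<..<e})"
        by (rule has_derivative_transform[rotated 2]) (use e \<gamma> inv in \<open>auto simp: image_subset_iff\<close>)
      then have "(\<lambda>h. \<Psi> (D (h *\<^sub>R v))) = (\<lambda>h. h *\<^sub>R v)"
        using 1 unfolding at0 by (rule has_derivative_unique)
      then show ?thesis by (metis scaleR_one)
    qed
    have "D v \<bullet> D w = inverse \<mu> * (v \<bullet> w)"
      if "v \<in> tangent_vectors X p" "w \<in> tangent_vectors X p" for v w
      using inner[of "D v" "D w"] \<mu> \<Psi>D that by simp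
    moreover have "inverse \<mu> > 0" using \<mu> by simp
    ultimately show ?thesis using D
      by (intro exI[of _ "inverse \<mu>"] conjI exI[of _ D]) simp_all
  qed
  then have "\<forall>p\<in>X. \<exists>\<mu>. \<mu> > 0 \<and> (\<exists>D. (\<phi> has_derivative D) (at p within X) \<and>
      (\<forall>v\<in>tangent_vectors X p. \<forall>w\<in>tangent_vectors X p. D v \<bullet> D w = \<mu> * (v \<bullet> w)))"
    by simp
  from bchoice[OF this] obtain \<mu> where "\<forall>p\<in>X. \<mu> p > 0 \<and> (\<exists>D. (\<phi> has_derivative D) (at p within X) \<and>
      (\<forall>v\<in>tangent_vectors X p. \<forall>w\<in>tangent_vectors X p. D v \<bullet> D w = \<mu> p * (v \<bullet> w)))" ..
  with diffeo show ?thesis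
    unfolding conformal_to_def by (intro exI[of _ \<phi>] exI[of _ \<mu>] conjI)
qed

section \<open>The isothermal radial parameter\<close>

lemma antiderivative_left_open:
  fixes h :: "real \<Rightarrow> real"
  assumes h: "continuous_on {0<..1} h"
  obtains t where "t 1 = 0"
    "\<forall>u\<in>{0<..1}. (t has_real_derivative - h u) (at u within {0<..1})"
proof -
  have "((\<lambda>u. integral {u..1} h) has_real_derivative - h u) (at u within {0<..1})"
    if u: "u \<in> {0<..1}" for u
  proof -
    \<comment> \<open>\<open>h\<close> may blow up at 0, so the integral is differentiated on a
      compact interval; starting at \<open>u/2\<close> makes it a neighbourhood of \<open>u\<close>
      relative to \<open>{0<..1}\<close>.\<close>
    have "continuous_on {u/2..1} h" using u by (intro continuous_on_subset[OF h]) auto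
    then have "((\<lambda>u. integral {u..1} h) has_vector_derivative - h u) (at u within {u/2..1})"
      using u by (intro integral_has_vector_derivative') auto
    moreover have "at u within {u/2..1} = at u within {0<..1}"
      using u by (intro at_within_nhd[where S = "{u/2<..}"]) auto
    ultimately show ?thesis by (simp add: has_real_derivative_iff_has_vector_derivative)
  qed
  then show thesis by (intro that[of "\<lambda>u. integral {u..1} h"]) auto
qed

lemma at_within_Ioc_interior: "u \<in> {0<..<1} \<Longrightarrow> at u within {0<..1} = at (u::real)"
  by (rule at_within_nhd[of u "{0<..<1}"]) auto

text \<open>\<open>s\<close> is the radius in the disc and \<open>S\<close> recovers the curve
  parameter from it. The equation \<open>s' = s * h\<close> says that \<open>h\<close> is the
  logarithmic derivative of the radius. Unboundedness is stated for every antiderivative of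
  \<open>- h\<close> because the one in use is constructed only inside the proof.\<close>

lemma isothermal_parameter:
  fixes h :: "real \<Rightarrow> real"
  assumes h: "continuous_on {0<..1} h" and pos: "\<And>u. u \<in> {0<..1} \<Longrightarrow> h u > 0"
    and unbounded: "\<And>t M. (\<And>u. u \<in> {0<..1} \<Longrightarrow> (t has_real_derivative - h u) (at u within {0<..1}))
        \<Longrightarrow> \<exists>u\<in>{0<..1}. t u > M"
  obtains s S where "s ` {0<..<1} = {0<..<1}" "\<forall>u\<in>{0<..<1}. S (s u) = u"
    "\<forall>u\<in>{0<..<1}. (s has_real_derivative s u * h u) (at u)"
    "continuous_on {0<..<1} s" "continuous_on {0<..<1} S"
    "\<forall>\<rho>\<in>{0<..<1}. (S has_real_derivative inverse (\<rho> * h (S \<rho>))) (at \<rho>)"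
    "continuous_on {0<..<1} (\<lambda>\<rho>. inverse (\<rho> * h (S \<rho>)))"
proof -
  obtain t where t1: "t 1 = 0"
    and t': "\<forall>u\<in>{0<..1}. (t has_real_derivative - h u) (at u within {0<..1})"
    by (rule antiderivative_left_open[OF h])
  note t = bspec[OF t']
  define s where "s = (\<lambda>u. exp (- t u))"
  have ds: "(s has_real_derivative s u * h u) (at u within {0<..1})" if "u \<in> {0<..1}" for u
    unfolding s_def using t[OF that] by (auto intro!: derivative_eq_intros)
  have ds': "(s has_real_derivative s u * h u) (at u)" if "u \<in> {0<..<1}" for u
    using ds[of u] that by (simp add: at_within_Ioc_interior)
  have conts: "continuous_on {0<..1} s"
    unfolding continuous_on_eq_continuous_within by (intro ballI DERIV_continuous[OF ds])
  have mono: "s a < s b" if ab: "0 < a" "a < b" "b \<le> 1" for a b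
  \<comment> \<open>For \<open>b = 1\<close> only a one-sided derivative is available, so
    monotonicity rests on derivatives in the open interval and continuity on the closed one.\<close>
  proof (rule DERIV_pos_imp_increasing_open[OF ab(2)])
    show "\<exists>y. (s has_real_derivative y) (at x) \<and> 0 < y" if "a < x" "x < b" for x
      using ds'[of x] pos[of x] that ab by (intro exI[of _ "s x * h x"]) (auto simp: s_def)
    show "continuous_on {a..b} s" using ab by (intro continuous_on_subset[OF conts]) auto
  qed
  have s1: "s 1 = 1" by (simp add: s_def t1)
  have image: "s ` {0<..<1} = {0<..<1}"
  proof (intro equalityI subsetI)
    fix y assume "y \<in> s ` {0<..<1}"
    then show "y \<in> {0<..<1}" using mono[of _ 1] s1 by (auto simp: s_def)
  next
    fix y :: real assume y: "y \<in> {0<..<1}"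
    \<comment> \<open>Unboundedness of \<open>t\<close> makes \<open>s\<close> drop below
      \<open>y\<close>; as \<open>s 1 = 1\<close> lies above \<open>y\<close>, the value is attained
      in between, and strictly before 1.\<close>
    obtain a where a: "a \<in> {0<..1}" "t a > - ln y" using unbounded[OF t, of "- ln y"] by blast
    then have "s a < y" using y unfolding s_def
      by (metis exp_less_mono exp_ln greaterThanLessThan_iff minus_less_iff)
    moreover have "continuous_on {a..1} s" using a by (intro continuous_on_subset[OF conts]) auto
    ultimately obtain u where "a \<le> u" "u \<le> 1" "s u = y"
      using IVT'[of s a y 1] a y s1 by auto
    then show "y \<in> s ` {0<..<1}" using a y s1 by (intro image_eqI[of _ _ u]) (auto simp: less_le)
  qed
  have inj: "inj_on s {0<..<1}"
    using mono by (intro linorder_inj_onI) force+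
  have cont': "continuous_on {0<..<1} (\<lambda>u. s u * h u)"
    by (intro continuous_on_mult continuous_on_subset[OF conts] continuous_on_subset[OF h]) auto
  have nz: "s u * h u \<noteq> 0" if "u \<in> {0<..<1}" for u
    using pos[of u] that by (simp add: s_def)
  obtain S where "open (s ` {0<..<1})" and S: "\<forall>u\<in>{0<..<1}. S (s u) = u"
    "\<forall>y\<in>s ` {0<..<1}. (S has_real_derivative inverse (s (S y) * h (S y))) (at y)"
    "continuous_on (s ` {0<..<1}) (\<lambda>y. inverse (s (S y) * h (S y)))"
    by (rule C1_inverse_real[OF open_greaterThanLessThan ds' nz cont' inj])
  have sS: "s (S y) = y" if "y \<in> {0<..<1}" for y
    using that S(1) image by (metis imageE)
  have dS: "(S has_real_derivative inverse (y * h (S y))) (at y)" if "y \<in> {0<..<1}" for y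
    using bspec[OF S(2), of y] that sS image by simp
  show thesis
  proof (rule that[OF image S(1)])
    show "\<forall>u\<in>{0<..<1}. (s has_real_derivative s u * h u) (at u)" by (intro ballI ds')
    show "\<forall>\<rho>\<in>{0<..<1}. (S has_real_derivative inverse (\<rho> * h (S \<rho>))) (at \<rho>)"
      by (intro ballI dS)
    show "continuous_on {0<..<1} s" by (rule continuous_on_subset[OF conts]) auto
    show "continuous_on {0<..<1} S"
      by (intro continuous_at_imp_continuous_on ballI DERIV_isCont[OF dS])
    show "continuous_on {0<..<1} (\<lambda>y. inverse (y * h (S y)))"
      using S(3)[unfolded image] by (rule continuous_on_cong[OF refl, THEN iffD1, rotated]) (simp add: sS)
  qed
qed

section \<open>Hyperbolic completeness along a curve\<close>

text \<open>
  The form \<open>norm (\<Gamma>' u) / (\<Gamma> u \<bullet> e)\<close> is the hyperbolic speed of \<open>\<Gamma>\<close> in the half-space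
  \<open>{x. x \<bullet> e > 0}\<close>, so this is completeness of the hyperbolic metric along one curve.
\<close>

lemma finite_hyperbolic_length_imp_convergent:
  fixes \<Gamma> \<Gamma>' :: "real \<Rightarrow> 'a::euclidean_space"
  assumes \<Gamma>: "\<And>u. u \<in> {0<..1} \<Longrightarrow> (\<Gamma> has_vector_derivative \<Gamma>' u) (at u within {0<..1})"
    and pos: "\<And>u. u \<in> {0<..1} \<Longrightarrow> \<Gamma> u \<bullet> e > 0" and e: "norm e = 1"
    and t: "\<And>u. u \<in> {0<..1} \<Longrightarrow>
        (t has_real_derivative - (norm (\<Gamma>' u) / (\<Gamma> u \<bullet> e))) (at u within {0<..1})"
    and bounded: "\<And>u. u \<in> {0<..1} \<Longrightarrow> t u \<le> M"
  obtains p where "(\<lambda>k. \<Gamma> (1 / real (Suc k))) \<longlonglongrightarrow> p" "p \<bullet> e > 0"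
proof -
  define r where "r = (\<lambda>u. \<Gamma> u \<bullet> e)"
  have rpos: "r u > 0" if "u \<in> {0<..1}" for u using pos that by (simp add: r_def)
  have cont: "continuous_on {0<..1} \<Gamma>" "continuous_on {0<..1} t"
    unfolding continuous_on_eq_continuous_within
    by (intro ballI has_vector_derivative_continuous[OF \<Gamma>] DERIV_continuous[OF t], assumption)+
  have dt: "((\<lambda>u. - t u) has_vector_derivative norm (\<Gamma>' u) / r u) (at u)"
    if "u \<in> {0<..<1}" for u
    using t[of u] that DERIV_minus[of t "- (norm (\<Gamma>' u) / r u)" u UNIV]
    by (simp add: at_within_Ioc_interior r_def has_real_derivative_iff_has_vector_derivative)
  have d\<Gamma>: "(\<Gamma> has_vector_derivative \<Gamma>' u) (at u)" if "u \<in> {0<..<1}" for u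
    using \<Gamma>[of u] that by (simp add: at_within_Ioc_interior)
  have dr: "(r has_real_derivative \<Gamma>' u \<bullet> e) (at u)" if "u \<in> {0<..<1}" for u
    using d\<Gamma>[OF that] unfolding r_def has_vector_derivative_def has_field_derivative_def
    by (auto intro!: derivative_eq_intros)
  \<comment> \<open>Since \<open>e\<close> is a unit vector, the derivative of \<open>r\<close> is
    at most \<open>norm (\<Gamma>' u)\<close> in absolute value, so \<open>ln r\<close> varies no
    faster than \<open>t\<close>.\<close>
  have log_bound: "\<bar>ln (r b) - ln (r a)\<bar> \<le> t a - t b" if ab: "0 < a" "a \<le> b" "b \<le> 1" for a b
  proof (cases "a = b")
    case False
    have sub: "{a..b} \<subseteq> {0<..1}" using ab by auto
    have "norm (ln (r b) - ln (r a)) \<le> - t b - (- t a)"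
    proof (rule differentiable_bound_general[where f' = "\<lambda>u. \<Gamma>' u \<bullet> e / r u"
          and \<phi>' = "\<lambda>u. norm (\<Gamma>' u) / r u"])
      show "continuous_on {a..b} (\<lambda>u. ln (r u))"
        using sub rpos unfolding r_def
        by (intro continuous_on_ln continuous_on_inner continuous_on_subset[OF cont(1) sub])
           (force intro: continuous_on_const)+
      show "continuous_on {a..b} (\<lambda>u. - t u)"
        by (intro continuous_on_minus continuous_on_subset[OF cont(2) sub])
      fix x assume x: "a < x" "x < b"
      then have x': "x \<in> {0<..<1}" using ab by auto
      show "((\<lambda>u. ln (r u)) has_vector_derivative \<Gamma>' x \<bullet> e / r x) (at x)"
        unfolding has_real_derivative_iff_has_vector_derivative[symmetric]
        using rpos[of x] x' dr[OF x'] by (auto intro!: derivative_eq_intros)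
      show "((\<lambda>u. - t u) has_vector_derivative norm (\<Gamma>' x) / r x) (at x)" by (rule dt[OF x'])
      show "norm (\<Gamma>' x \<bullet> e / r x) \<le> norm (\<Gamma>' x) / r x"
        using rpos[of x] x' Cauchy_Schwarz_ineq2[of "\<Gamma>' x" e] e
        by (simp add: divide_right_mono)
    qed (use ab False in auto)
    then show ?thesis by simp
  qed simp
  have t_anti: "t b \<le> t a" if "0 < a" "a \<le> b" "b \<le> 1" for a b
    using log_bound[OF that] by simp
  \<comment> \<open>Comparing \<open>u\<close> with 1 in \<open>log_bound\<close> and using
    \<open>t u \<le> M\<close> confines \<open>r u\<close> between two positive constants;
    \<open>K\<close> is the upper one.\<close>
  define K where "K = r 1 * exp (M - t 1)"
  have r_bounds: "r 1 * exp (t 1 - M) \<le> r u" "r u \<le> K" if u: "u \<in> {0<..1}" for u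
  proof -
    have "\<bar>ln (r 1) - ln (r u)\<bar> \<le> M - t 1" using log_bound[of u 1] bounded[OF u] u by auto
    then have "ln (r 1) + (t 1 - M) \<le> ln (r u)" "ln (r u) \<le> ln (r 1) + (M - t 1)" by linarith+
    then have "exp (ln (r 1) + (t 1 - M)) \<le> exp (ln (r u))"
      "exp (ln (r u)) \<le> exp (ln (r 1) + (M - t 1))" by simp_all
    then show "r 1 * exp (t 1 - M) \<le> r u" "r u \<le> K"
      using rpos[OF u] rpos[of 1] by (simp_all add: exp_add K_def)
  qed
  have K: "K > 0" using rpos[of 1] by (simp add: K_def)
  \<comment> \<open>As \<open>r \<le> K\<close>, the Euclidean speed is at most \<open>K\<close>
    times the hyperbolic speed, so differences of \<open>t\<close> also control Euclidean
    displacement.\<close>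
  have \<Gamma>_bound: "norm (\<Gamma> b - \<Gamma> a) \<le> K * (t a - t b)" if ab: "0 < a" "a \<le> b" "b \<le> 1" for a b
  proof (cases "a = b")
    case False
    have sub: "{a..b} \<subseteq> {0<..1}" using ab by auto
    have "norm (\<Gamma> b - \<Gamma> a) \<le> K * - t b - K * - t a"
    proof (rule differentiable_bound_general[where f' = \<Gamma>'
          and \<phi>' = "\<lambda>u. K * (norm (\<Gamma>' u) / r u)"])
      show "continuous_on {a..b} \<Gamma>" by (rule continuous_on_subset[OF cont(1) sub])
      show "continuous_on {a..b} (\<lambda>u. K * - t u)"
        by (intro continuous_intros continuous_on_subset[OF cont(2) sub])
      fix x assume x: "a < x" "x < b"
      then have x': "x \<in> {0<..<1}" using ab by auto
      show "(\<Gamma> has_vector_derivative \<Gamma>' x) (at x)" by (rule d\<Gamma>[OF x'])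
      show "((\<lambda>u. K * - t u) has_vector_derivative K * (norm (\<Gamma>' x) / r x)) (at x)"
        by (rule has_vector_derivative_mult_right[OF dt[OF x']])
      have "norm (\<Gamma>' x) * r x \<le> norm (\<Gamma>' x) * K"
        using r_bounds(2)[of x] x' by (intro mult_left_mono) auto
      then show "norm (\<Gamma>' x) \<le> K * (norm (\<Gamma>' x) / r x)"
        using rpos[of x] x' by (simp add: field_simps)
    qed (use ab False in auto)
    then show ?thesis by (simp add: algebra_simps)
  qed simp
  \<comment> \<open>Along these parameters, which decrease to 0, \<open>t\<close> is increasing and
    bounded, hence Cauchy; the displacement estimate passes this on to the points of the
    curve.\<close>
  define x where "x = (\<lambda>k. 1 / real (Suc k))"
  have x01: "x k \<in> {0<..1}" for k by (simp add: x_def)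
  have x_anti: "x l \<le> x k" if "k \<le> l" for k l using that by (simp add: x_def frac_le)
  have incseq: "incseq (\<lambda>k. t (x k))"
    using x01 x_anti by (intro monoI t_anti) auto
  have "\<forall>k. t (x k) \<le> M" using bounded x01 by simp
  with incseq obtain L where "(\<lambda>k. t (x k)) \<longlonglongrightarrow> L" "\<forall>k. t (x k) \<le> L"
    by (rule incseq_convergent)
  then have Cauchy_t: "Cauchy (\<lambda>k. t (x k))" by (simp add: LIMSEQ_imp_Cauchy)
  have "Cauchy (\<lambda>k. \<Gamma> (x k))"
  proof (rule CauchyI)
    fix \<epsilon> :: real assume "\<epsilon> > 0"
    then obtain N where N: "\<And>k l. k \<ge> N \<Longrightarrow> l \<ge> N \<Longrightarrow> norm (t (x k) - t (x l)) < \<epsilon> / K"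
      using CauchyD[OF Cauchy_t, of "\<epsilon> / K"] K by auto
    have le: "norm (\<Gamma> (x k) - \<Gamma> (x l)) < \<epsilon>" if "N \<le> k" "k \<le> l" for k l
    proof -
      have "norm (\<Gamma> (x k) - \<Gamma> (x l)) \<le> K * (t (x l) - t (x k))"
        using \<Gamma>_bound[of "x l" "x k"] x01[of l] x01[of k] x_anti[of k l] that by auto
      also have "\<dots> < K * (\<epsilon> / K)"
        using N[of l k] that K by (intro mult_strict_left_mono) auto
      finally show ?thesis using K by simp
    qed
    show "\<exists>N. \<forall>m\<ge>N. \<forall>n\<ge>N. norm (\<Gamma> (x m) - \<Gamma> (x n)) < \<epsilon>"
    proof (intro exI allI impI)
      fix k l assume "N \<le> k" "N \<le> l"
      then show "norm (\<Gamma> (x k) - \<Gamma> (x l)) < \<epsilon>"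
        using le[of k l] le[of l k] by (cases "k \<le> l") (simp_all add: norm_minus_commute)
    qed
  qed
  then obtain p where p: "(\<lambda>k. \<Gamma> (x k)) \<longlonglongrightarrow> p" by (auto simp: Cauchy_convergent_iff convergent_def)
  have "(\<lambda>k. r (x k)) \<longlonglongrightarrow> p \<bullet> e" unfolding r_def by (intro tendsto_intros p)
  \<comment> \<open>The uniform lower bound on \<open>r\<close> survives in the limit and keeps
    \<open>p\<close> off the boundary hyperplane.\<close>
  then have "r 1 * exp (t 1 - M) \<le> p \<bullet> e"
    by (rule LIMSEQ_le_const) (intro exI allI impI r_bounds(1) x01)
  moreover have "r 1 * exp (t 1 - M) > 0" using rpos[of 1] by simp
  ultimately show thesis using p by (intro that[of p]) (simp_all add: x_def)
qed

section \<open>Rotationally symmetric maps in polar form\<close>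

text \<open>Writing the map through \<open>w\<close> and \<open>norm w\<close> avoids choosing a
  branch of the angle; away from 0 the differential of the norm is the component along
  \<open>sgn w\<close>.\<close>

lemma has_derivative_polar:
  fixes w :: "'a::euclidean_space"
  assumes w: "w \<noteq> 0" and A: "(A has_real_derivative A') (at (norm w))"
    and B: "(B has_real_derivative B') (at (norm w))"
  shows "((\<lambda>w. (A (norm w) *\<^sub>R w, B (norm w))) has_derivative
    (\<lambda>a. (A (norm w) *\<^sub>R a + (A' * (a \<bullet> sgn w)) *\<^sub>R w, B' * (a \<bullet> sgn w)))) (at w)"
proof -
  have n: "(norm has_derivative (\<lambda>a. a \<bullet> sgn w)) (at w)" by (rule has_derivative_norm[OF w])
  have "((\<lambda>w. A (norm w)) has_derivative (\<lambda>a. A' * (a \<bullet> sgn w))) (at w)"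
    "((\<lambda>w. B (norm w)) has_derivative (\<lambda>a. B' * (a \<bullet> sgn w))) (at w)"
    using has_derivative_compose[OF n] A B by (auto simp: has_field_derivative_def)
  then show ?thesis by (auto intro!: derivative_eq_intros)
qed

text \<open>The differential stretches vectors orthogonal to \<open>w\<close> by the factor
  \<open>\<alpha>\<close>, up to sign, and the radial unit vector to squared length
  \<open>(\<alpha> + norm w * A')\<^sup>2 + B'\<^sup>2\<close>. These images are orthogonal, so
  conformality amounts to equality of the two squares.\<close>

lemma inner_polar:
  fixes w :: "'a::euclidean_space"
  assumes w: "w \<noteq> 0" and conf: "(\<alpha> + norm w * A')\<^sup>2 + B'\<^sup>2 = \<alpha>\<^sup>2"
  shows "(\<alpha> *\<^sub>R a + (A' * (a \<bullet> sgn w)) *\<^sub>R w, B' * (a \<bullet> sgn w)) \<bullet>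
         (\<alpha> *\<^sub>R b + (A' * (b \<bullet> sgn w)) *\<^sub>R w, B' * (b \<bullet> sgn w)) = \<alpha>\<^sup>2 * (a \<bullet> b)"
proof -
  define \<rho> v x y where "\<rho> = norm w" and "v = sgn w" and "x = a \<bullet> v" and "y = b \<bullet> v"
  have wv: "w = \<rho> *\<^sub>R v" using w by (simp add: \<rho>_def v_def sgn_div_norm)
  have vv: "v \<bullet> v = 1" using w by (simp add: v_def dot_square_norm norm_sgn)
  have 1: "a \<bullet> sgn w = x" "b \<bullet> sgn w = y" "v \<bullet> b = y" "v \<bullet> a = x" "a \<bullet> v = x" "b \<bullet> v = y"
    by (simp_all add: x_def y_def v_def inner_commute)
  have "(\<alpha> *\<^sub>R a + (A' * x) *\<^sub>R w, B' * x) \<bullet> (\<alpha> *\<^sub>R b + (A' * y) *\<^sub>R w, B' * y)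
    = \<alpha>\<^sup>2 * (a \<bullet> b) + x * y * ((\<alpha> + \<rho> * A')\<^sup>2 + B'\<^sup>2 - \<alpha>\<^sup>2)"
    by (simp add: wv inner_add_left inner_add_right 1 vv power2_eq_square algebra_simps)
  then show ?thesis using conf by (simp add: 1 \<rho>_def)
qed

section \<open>Surfaces of revolution in an orthonormal frame\<close>

text \<open>The axis has direction \<open>e3\<close>, the curve lies in the open half-plane where
  the \<open>e1\<close> component is positive, and a unit complex number \<open>\<zeta>\<close>
  replaces the angle, turning \<open>e1\<close> towards \<open>e2\<close>.\<close>

lemma conformal_surface_of_revolution:
  fixes \<Gamma> :: "real \<Rightarrow> 'a::euclidean_space" and e1 e2 e3 :: 'a
  assumes orth: "e1 \<bullet> e1 = 1" "e2 \<bullet> e2 = 1" "e3 \<bullet> e3 = 1" "e1 \<bullet> e2 = 0" "e1 \<bullet> e3 = 0" "e2 \<bullet> e3 = 0"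
    and curve: "regular_embedded_C1_curve_on \<Gamma> {0<..1}"
    and plane: "\<And>u. u \<in> {0<..1} \<Longrightarrow> \<Gamma> u = (\<Gamma> u \<bullet> e1) *\<^sub>R e1 + (\<Gamma> u \<bullet> e3) *\<^sub>R e3"
    and pos: "\<And>u. u \<in> {0<..1} \<Longrightarrow> \<Gamma> u \<bullet> e1 > 0"
    and boundary: "\<And>p. p \<in> closure (\<Gamma> ` {0<..1}) - \<Gamma> ` {0<..1} \<Longrightarrow> p \<bullet> e1 = 0"
  shows "conformal_to {x. \<exists>u\<in>{0<..<1}. \<exists>\<zeta>. norm \<zeta> = 1 \<and>
      x = (\<Gamma> u \<bullet> e1) *\<^sub>R (Re \<zeta> *\<^sub>R e1 + Im \<zeta> *\<^sub>R e2) + (\<Gamma> u \<bullet> e3) *\<^sub>R e3} punctured_unit_disc"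
    (is "conformal_to ?V _")
proof -
  obtain \<Gamma>' g where deriv: "\<forall>u\<in>{0<..1}. (\<Gamma> has_vector_derivative \<Gamma>' u) (at u within {0<..1}) \<and> \<Gamma>' u \<noteq> 0"
    and cont': "continuous_on {0<..1} \<Gamma>'" and hom: "homeomorphism {0<..1} (\<Gamma> ` {0<..1}) \<Gamma> g"
    using curve unfolding regular_embedded_C1_curve_on_def by (elim exE conjE)
  have d: "(\<Gamma> has_vector_derivative \<Gamma>' u) (at u within {0<..1})" if "u \<in> {0<..1}" for u
    using deriv that by simp
  have \<Gamma>'0: "\<Gamma>' u \<noteq> 0" if "u \<in> {0<..1}" for u
    using deriv that by simp
  have cont: "continuous_on {0<..1} \<Gamma>" using hom by (simp add: homeomorphism_def)
  define r z r' z' where "r = (\<lambda>u. \<Gamma> u \<bullet> e1)" and "z = (\<lambda>u. \<Gamma> u \<bullet> e3)"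
    and "r' = (\<lambda>u. \<Gamma>' u \<bullet> e1)" and "z' = (\<lambda>u. \<Gamma>' u \<bullet> e3)"
  have r: "r u > 0" if "u \<in> {0<..1}" for u using pos[OF that] by (simp add: r_def)
  have contr: "continuous_on {0<..1} r" "continuous_on {0<..1} z"
    "continuous_on {0<..1} r'" "continuous_on {0<..1} z'"
    unfolding r_def z_def r'_def z'_def by (intro continuous_on_inner continuous_on_const cont cont')+
  define h where "h = (\<lambda>u. norm (\<Gamma>' u) / r u)"
  have conth: "continuous_on {0<..1} h"
    unfolding h_def by (intro continuous_on_divide continuous_on_norm cont' contr ballI) (use r in force)
  have h: "h u > 0" if "u \<in> {0<..1}" for u
    using r[OF that] \<Gamma>'0[OF that] by (simp add: h_def)
  have unbounded: "\<exists>u\<in>{0<..1}. t u > M"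
    if t: "\<And>u. u \<in> {0<..1} \<Longrightarrow> (t has_real_derivative - h u) (at u within {0<..1})" for t M
  proof (rule ccontr)
    assume "\<not> (\<exists>u\<in>{0<..1}. t u > M)"
    then have M: "t u \<le> M" if "u \<in> {0<..1}" for u using that by force
    have e1: "norm e1 = 1" using orth(1) by (simp add: norm_eq_sqrt_inner)
    obtain p where p: "(\<lambda>k. \<Gamma> (1 / real (Suc k))) \<longlonglongrightarrow> p" "p \<bullet> e1 > 0"
      by (rule finite_hyperbolic_length_imp_convergent[OF d pos e1 t[unfolded h_def r_def] M])
    have in_\<Gamma>: "\<Gamma> (1 / real (Suc k)) \<in> \<Gamma> ` {0<..1}" for k by (intro imageI) simp
    then have "p \<in> closure (\<Gamma> ` {0<..1})"
      unfolding closure_sequential using p(1)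
      by (intro exI[of _ "\<lambda>k. \<Gamma> (1 / real (Suc k))"]) simp
    then have p_in: "p \<in> \<Gamma> ` {0<..1}" using boundary[of p] p(2) by fastforce
    \<comment> \<open>Continuity of \<open>g\<close> on the curve turns convergence of the points
      into convergence of their parameters, whose limit 0 lies outside
      \<open>{0<..1}\<close>.\<close>
    have "continuous_on (\<Gamma> ` {0<..1}) g" using hom by (simp add: homeomorphism_def)
    then have "(\<lambda>k. g (\<Gamma> (1 / real (Suc k)))) \<longlonglongrightarrow> g p"
      by (rule continuous_on_tendsto_compose[OF _ p(1) p_in]) (simp add: in_\<Gamma>)
    moreover have "g (\<Gamma> (1 / real (Suc k))) = 1 / real (Suc k)" for k
      using hom by (simp add: homeomorphism_def)
    ultimately have "(\<lambda>k. 1 / real (Suc k)) \<longlonglongrightarrow> g p" by simp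
    moreover have "(\<lambda>k. 1 / real (Suc k)) \<longlonglongrightarrow> 0" by (rule LIMSEQ_Suc[OF lim_1_over_n])
    ultimately have "g p = 0" by (rule LIMSEQ_unique)
    moreover have "g p \<in> {0<..1}" using hom p_in by (auto simp: homeomorphism_def)
    ultimately show False by simp
  qed
  obtain s S where s_image: "s ` {0<..<1} = {0<..<1}" and Ss: "\<forall>u\<in>{0<..<1}. S (s u) = u"
    and ds: "\<forall>u\<in>{0<..<1}. (s has_real_derivative s u * h u) (at u)"
    and conts: "continuous_on {0<..<1} s" and contS: "continuous_on {0<..<1} S"
    and dS: "\<forall>\<rho>\<in>{0<..<1}. (S has_real_derivative inverse (\<rho> * h (S \<rho>))) (at \<rho>)"
    and contS': "continuous_on {0<..<1} (\<lambda>\<rho>. inverse (\<rho> * h (S \<rho>)))"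
    by (rule isothermal_parameter[OF conth h unbounded])
  have s01: "s u \<in> {0<..<1}" if "u \<in> {0<..<1}" for u using s_image that by blast
  have S01: "S \<rho> \<in> {0<..<1}" and sS: "s (S \<rho>) = \<rho>" if \<rho>: "\<rho> \<in> {0<..<1}" for \<rho>
  proof -
    from \<rho> s_image have "\<rho> \<in> s ` {0<..<1}" by simp
    then obtain u where "u \<in> {0<..<1}" "\<rho> = s u" by (elim imageE)
    then show "S \<rho> \<in> {0<..<1}" "s (S \<rho>) = \<rho>" using Ss by simp_all
  qed
  have d': "(\<Gamma> has_vector_derivative \<Gamma>' u) (at u)" if "u \<in> {0<..<1}" for u
    using d[of u] that by (simp add: at_within_Ioc_interior)
  have dr: "(r has_real_derivative r' u) (at u)" and dz: "(z has_real_derivative z' u) (at u)"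
    if "u \<in> {0<..<1}" for u
    using d'[OF that] unfolding r_def r'_def z_def z'_def has_vector_derivative_def has_field_derivative_def
    by (auto intro!: derivative_eq_intros)
  have speed: "(norm (\<Gamma>' u))\<^sup>2 = (r' u)\<^sup>2 + (z' u)\<^sup>2" if u: "u \<in> {0<..<1}" for u
  proof -
    \<comment> \<open>Differentiating the plane equation keeps the velocity in the plane, so its
      \<open>e1\<close> and \<open>e3\<close> components account for its whole length.\<close>
    have "((\<lambda>u. r u *\<^sub>R e1 + z u *\<^sub>R e3) has_vector_derivative r' u *\<^sub>R e1 + z' u *\<^sub>R e3) (at u)"
      using dr[OF u] dz[OF u] by (auto intro!: derivative_eq_intros)
    then have "(\<Gamma> has_vector_derivative r' u *\<^sub>R e1 + z' u *\<^sub>R e3) (at u)"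
      by (rule has_vector_derivative_transform_within_open[of _ _ _ "{0<..<1}"])
         (use u plane in \<open>auto simp: r_def z_def\<close>)
    then have "\<Gamma>' u = r' u *\<^sub>R e1 + z' u *\<^sub>R e3" by (rule vector_derivative_unique_at[OF d'[OF u]])
    then have "\<Gamma>' u \<bullet> \<Gamma>' u = r' u * r' u + z' u * z' u"
      by (simp only: inner_add_left inner_add_right inner_scaleR_left inner_scaleR_right orth
          inner_commute[of e3 e1]) simp
    then show ?thesis
      unfolding power2_norm_eq_inner by (simp only: power2_eq_square)
  qed
  \<comment> \<open>\<open>Q\<close> is an isometric embedding of
    \<open>complex \<times> real\<close> as the span of the frame, and \<open>P\<close> reads off
    the horizontal part as a complex number.\<close>
  define Q where "Q = (\<lambda>p :: complex \<times> real. Re (fst p) *\<^sub>R e1 + Im (fst p) *\<^sub>R e2 + snd p *\<^sub>R e3)"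
  define P where "P = (\<lambda>x. Complex (x \<bullet> e1) (x \<bullet> e2))"
  have Q_linear: "bounded_linear Q"
    unfolding Q_def by (intro bounded_linear_intros bounded_linear_Re bounded_linear_Im
      bounded_linear_compose[OF bounded_linear_Re] bounded_linear_compose[OF bounded_linear_Im])
  have P_linear: "bounded_linear P"
    unfolding P_def Complex_eq
    by (intro bounded_linear_intros bounded_linear_compose[OF bounded_linear_of_real] bounded_linear_const_mult)
  have Q_inner: "Q p \<bullet> Q q = p \<bullet> q" for p q
    using orth by (cases p; cases q)
      (simp add: Q_def inner_complex_def inner_add_left inner_add_right inner_commute algebra_simps)
  have PQ: "P (Q p) = fst p" and Qe3: "Q p \<bullet> e3 = snd p" for p
    using orth by (simp_all add: P_def Q_def inner_add_left inner_add_right inner_commute complex_eq_iff)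
  define X where "X = (\<lambda>u \<zeta>. Q (r u *\<^sub>R \<zeta>, z u))"
  have V: "?V = {x. \<exists>u\<in>{0<..<1}. \<exists>\<zeta>. norm \<zeta> = 1 \<and> x = X u \<zeta>}"
    by (simp add: X_def Q_def r_def z_def scaleR_add_right)
  \<comment> \<open>Replacing the horizontal part by its modulus turns a point of the surface back
    into the half-plane of the curve, where \<open>g\<close> returns its parameter.\<close>
  define U where "U = (\<lambda>x. g (norm (P x) *\<^sub>R e1 + (x \<bullet> e3) *\<^sub>R e3))"
  have profile: "norm (P (X u \<zeta>)) *\<^sub>R e1 + (X u \<zeta> \<bullet> e3) *\<^sub>R e3 = \<Gamma> u"
    if "u \<in> {0<..<1}" "norm \<zeta> = 1" for u \<zeta>
    using plane[of u] pos[of u] that by (simp add: X_def PQ Qe3 r_def z_def)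
  have UX: "U (X u \<zeta>) = u" if "u \<in> {0<..<1}" "norm \<zeta> = 1" for u \<zeta>
    using profile[OF that] that hom by (simp add: U_def homeomorphism_def)
  have U: "C1_map_on U ?V"
  proof -
    have "C1_map_on P ?V" by (rule C1_map_on_bounded_linear[OF P_linear])
    moreover have "C1_map_on norm (P ` ?V)"
    \<comment> \<open>The norm is differentiable only off 0; on the surface the modulus of
      \<open>P\<close> is \<open>r u\<close>, which is positive.\<close>
    proof (rule C1_map_on_norm, rule notI)
      assume "0 \<in> P ` ?V"
      then obtain u \<zeta> where u: "u \<in> {0<..<1}" and \<zeta>: "norm \<zeta> = 1" and "0 = P (X u \<zeta>)"
        unfolding V by auto
      then have "r u *\<^sub>R \<zeta> = 0" by (simp add: X_def PQ)
      then show False using r[of u] u \<zeta> by auto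
    qed
    ultimately have "C1_map_on (\<lambda>x. norm (P x)) ?V"
      by (rule C1_map_on_compose) simp
    moreover have "C1_map_on (\<lambda>x. x \<bullet> e3) ?V"
      by (rule C1_map_on_bounded_linear[OF bounded_linear_inner_left])
    ultimately have pair: "C1_map_on (\<lambda>x. (norm (P x), x \<bullet> e3)) ?V" by (rule C1_map_on_Pair)
    have "C1_map_on (\<lambda>p :: real \<times> real. fst p *\<^sub>R e1 + snd p *\<^sub>R e3) UNIV"
      by (rule C1_map_on_bounded_linear) (intro bounded_linear_intros)
    from C1_map_on_compose[OF pair this]
    have E: "C1_map_on (\<lambda>x. norm (P x) *\<^sub>R e1 + (x \<bullet> e3) *\<^sub>R e3) ?V" by simp
    \<comment> \<open>Dropping the endpoint 1 leaves an open parameter interval with two-sided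
      derivatives, as the inverse-curve lemma requires.\<close>
    have hom': "homeomorphism {0<..<1} (\<Gamma> ` {0<..<1}) \<Gamma> g"
      by (rule homeomorphism_of_subsets[OF hom _ _ refl]) auto
    have "C1_map_on g (\<Gamma> ` {0<..<1})"
      by (rule C1_map_on_inverse_curve[OF open_greaterThanLessThan d' _ continuous_on_subset[OF cont'] hom'])
         (use \<Gamma>'0 in auto)
    moreover have "(\<lambda>x. norm (P x) *\<^sub>R e1 + (x \<bullet> e3) *\<^sub>R e3) ` ?V \<subseteq> \<Gamma> ` {0<..<1}"
      unfolding V using profile by auto
    ultimately show ?thesis unfolding U_def by (rule C1_map_on_compose[OF E])
  qed
  \<comment> \<open>The horizontal part has modulus \<open>r u\<close>; rescaling it to modulus
    \<open>s u\<close> keeps the angle.\<close>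
  define \<phi> where "\<phi> = (\<lambda>x. (s (U x) / r (U x)) *\<^sub>R P x)"
  \<comment> \<open>For \<open>\<psi>\<close> the horizontal part at radius \<open>\<rho>\<close>
    must have modulus \<open>r (S \<rho>)\<close>, while \<open>w\<close> already contributes
    \<open>\<rho>\<close>; \<open>B\<close> is the height.\<close>
  define A where "A = (\<lambda>\<rho>. r (S \<rho>) / \<rho>)"
  define B where "B = (\<lambda>\<rho>. z (S \<rho>))"
  define \<psi> where "\<psi> = (\<lambda>w. Q (A (norm w) *\<^sub>R w, B (norm w)))"
  have \<phi>X: "\<phi> (X u \<zeta>) = s u *\<^sub>R \<zeta>" if "u \<in> {0<..<1}" "norm \<zeta> = 1" for u \<zeta>
    using r[of u] that by (simp add: \<phi>_def UX) (simp add: X_def PQ)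
  have \<psi>_polar: "\<psi> (\<rho> *\<^sub>R \<zeta>) = X (S \<rho>) \<zeta>" if "\<rho> \<in> {0<..<1}" "norm \<zeta> = 1" for \<rho> \<zeta>
    using that by (simp add: \<psi>_def X_def A_def B_def)
  have disc: "w \<in> punctured_unit_disc \<longleftrightarrow> norm w \<in> {0<..<1}" for w
    by (simp add: punctured_unit_disc_def)
  have polar: "norm w *\<^sub>R sgn w = w" "norm (sgn w) = 1" if "w \<in> punctured_unit_disc" for w
    using that by (auto simp: disc sgn_div_norm norm_sgn)
  have C1_\<phi>: "C1_map_on \<phi> ?V"
  proof -
    have "C1_map_on (\<lambda>u. s u / r u) {0<..<1}"
    proof (rule C1_map_on_real[OF open_greaterThanLessThan])
      fix u :: real assume u: "u \<in> {0<..<1}"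
      show "((\<lambda>u. s u / r u) has_real_derivative (s u * h u * r u - s u * r' u) / (r u * r u)) (at u)"
        by (rule DERIV_divide[OF bspec[OF ds u] dr[OF u]]) (use r[of u] u in auto)
    next
      have "continuous_on {0<..<1} h" "continuous_on {0<..<1} r" "continuous_on {0<..<1} r'"
        by (rule continuous_on_subset[OF conth] continuous_on_subset[OF contr(1)]
            continuous_on_subset[OF contr(3)], force)+
      then show "continuous_on {0<..<1} (\<lambda>u. (s u * h u * r u - s u * r' u) / (r u * r u))"
        using conts r by (intro continuous_on_divide continuous_on_diff continuous_on_mult) force+
    qed
    moreover have "U ` ?V \<subseteq> {0<..<1}"
      unfolding V by (auto simp: UX)
    ultimately have "C1_map_on (\<lambda>x. s (U x) / r (U x)) ?V" by (rule C1_map_on_compose[OF U])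
    then show ?thesis
      unfolding \<phi>_def by (rule C1_map_on_scaleR[OF _ C1_map_on_bounded_linear[OF P_linear]])
  qed
  define S' where "S' = (\<lambda>\<rho>. inverse (\<rho> * h (S \<rho>)))"
  define A' where "A' = (\<lambda>\<rho>. (r' (S \<rho>) * S' \<rho> * \<rho> - r (S \<rho>)) / (\<rho> * \<rho>))"
  define B' where "B' = (\<lambda>\<rho>. z' (S \<rho>) * S' \<rho>)"
  have dB: "(B has_real_derivative B' \<rho>) (at \<rho>)"
    and dA: "(A has_real_derivative A' \<rho>) (at \<rho>)" if \<rho>: "\<rho> \<in> {0<..<1}" for \<rho>
  proof -
    have *: "(S has_real_derivative S' \<rho>) (at \<rho>)" unfolding S'_def by (rule bspec[OF dS \<rho>])
    show "(B has_real_derivative B' \<rho>) (at \<rho>)"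
      unfolding B_def B'_def by (rule DERIV_chain2[OF dz[OF S01[OF \<rho>]] *])
    have "((\<lambda>\<rho>. r (S \<rho>)) has_real_derivative r' (S \<rho>) * S' \<rho>) (at \<rho>)"
      by (rule DERIV_chain2[OF dr[OF S01[OF \<rho>]] *])
    from DERIV_divide[OF this DERIV_ident] show "(A has_real_derivative A' \<rho>) (at \<rho>)"
      using \<rho> by (simp add: A_def A'_def)
  qed
  have contA': "continuous_on {0<..<1} A'" and contB': "continuous_on {0<..<1} B'"
  proof -
    have sub: "S ` {0<..<1} \<subseteq> {0<..1}" using S01 by force
    have "continuous_on {0<..<1} (\<lambda>\<rho>. r (S \<rho>))" "continuous_on {0<..<1} (\<lambda>\<rho>. r' (S \<rho>))"
      "continuous_on {0<..<1} (\<lambda>\<rho>. z' (S \<rho>))"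
      by (rule continuous_on_compose2[OF _ contS sub], rule contr)+
    moreover have "continuous_on {0<..<1} S'" unfolding S'_def by (rule contS')
    ultimately show "continuous_on {0<..<1} A'" "continuous_on {0<..<1} B'"
      unfolding A'_def B'_def
      by (intro continuous_on_divide continuous_on_diff continuous_on_mult continuous_on_id; force)+
  qed
  have C1_\<psi>: "C1_map_on \<psi> punctured_unit_disc"
  proof -
    have n: "C1_map_on norm punctured_unit_disc"
      by (rule C1_map_on_norm) (simp add: disc)
    have sub: "norm ` punctured_unit_disc \<subseteq> {0<..<1}"
      by (auto simp: punctured_unit_disc_def)
    have "C1_map_on A {0<..<1}" "C1_map_on B {0<..<1}"
      by (rule C1_map_on_real[OF open_greaterThanLessThan dA contA'] 
          C1_map_on_real[OF open_greaterThanLessThan dB contB'], assumption)+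
    from this[THEN C1_map_on_compose[OF n _ sub]]
    have "C1_map_on (\<lambda>w. (A (norm w) *\<^sub>R w, B (norm w))) punctured_unit_disc"
      by (intro C1_map_on_Pair C1_map_on_scaleR C1_map_on_bounded_linear[OF bounded_linear_ident])
    from C1_map_on_compose[OF this C1_map_on_bounded_linear[OF Q_linear, of UNIV]] show ?thesis
      by (simp add: \<psi>_def)
  qed
  \<comment> \<open>Since \<open>\<rho> * A \<rho> = r (S \<rho>)\<close>, the left side is the
    squared speed of \<open>\<Gamma>\<close> reparametrized by \<open>S\<close>. The choice of
    \<open>h\<close> makes that speed \<open>r (S \<rho>) / \<rho>\<close>, which is the stretching
    along the circles of rotation.\<close>
  have isothermal: "(A \<rho> + \<rho> * A' \<rho>)\<^sup>2 + (B' \<rho>)\<^sup>2 = (A \<rho>)\<^sup>2" if \<rho>: "\<rho> \<in> {0<..<1}" for \<rho>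
  proof -
    let ?u = "S \<rho>"
    have u: "?u \<in> {0<..1}" using S01[OF \<rho>] by simp
    have "A \<rho> + \<rho> * A' \<rho> = r' ?u * S' \<rho>"
      using \<rho> by (simp add: A_def A'_def field_simps)
    then have "(A \<rho> + \<rho> * A' \<rho>)\<^sup>2 + (B' \<rho>)\<^sup>2 = (norm (\<Gamma>' ?u) * S' \<rho>)\<^sup>2"
      by (simp add: B'_def power_mult_distrib speed[OF S01[OF \<rho>]] algebra_simps)
    also have "norm (\<Gamma>' ?u) * S' \<rho> = A \<rho>"
      using r[OF u] \<Gamma>'0[OF u] \<rho> by (simp add: S'_def A_def h_def field_simps)
    finally show ?thesis .
  qed
  show ?thesis
  proof (rule conformal_toI[OF C1_\<phi> C1_\<psi>])
    fix x assume "x \<in> ?V"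
    then obtain u \<zeta> where x: "u \<in> {0<..<1}" "norm \<zeta> = 1" "x = X u \<zeta>" unfolding V by auto
    show "\<phi> x \<in> punctured_unit_disc"
      using s01[OF x(1)] x by (simp add: \<phi>X disc)
    show "\<psi> (\<phi> x) = x"
      using s01[OF x(1)] Ss x by (simp add: \<phi>X \<psi>_polar)
  next
    fix w assume w: "w \<in> punctured_unit_disc"
    then have \<rho>: "norm w \<in> {0<..<1}" by (simp add: disc)
    have \<psi>w: "\<psi> w = X (S (norm w)) (sgn w)"
      using \<psi>_polar[OF \<rho> polar(2)[OF w]] by (simp only: polar(1)[OF w])
    then show "\<psi> w \<in> ?V" unfolding V using S01[OF \<rho>] polar(2)[OF w] by auto
    show "\<phi> (\<psi> w) = w"
      using \<phi>X[OF S01[OF \<rho>] polar(2)[OF w]] by (simp only: \<psi>w sS[OF \<rho>] polar(1)[OF w])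
    have w0: "w \<noteq> 0" using \<rho> by auto
    let ?D = "\<lambda>a. (A (norm w) *\<^sub>R a + (A' (norm w) * (a \<bullet> sgn w)) *\<^sub>R w, B' (norm w) * (a \<bullet> sgn w))"
    have "(\<psi> has_derivative (\<lambda>a. Q (?D a))) (at w within punctured_unit_disc)"
      unfolding \<psi>_def
      by (rule bounded_linear.has_derivative[OF Q_linear
            has_derivative_at_withinI[OF has_derivative_polar[OF w0 dA[OF \<rho>] dB[OF \<rho>]]]])
    moreover have "(A (norm w))\<^sup>2 > 0" using r[of "S (norm w)"] S01[OF \<rho>] \<rho> by (simp add: A_def)
    moreover have "Q (?D a) \<bullet> Q (?D b) = (A (norm w))\<^sup>2 * (a \<bullet> b)" for a b
      unfolding Q_inner by (rule inner_polar[OF w0 isothermal[OF \<rho>]])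
    ultimately show "\<exists>\<Psi> \<mu>. (\<psi> has_derivative \<Psi>) (at w within punctured_unit_disc) \<and> \<mu> > 0 \<and>
        (\<forall>a b. \<Psi> a \<bullet> \<Psi> b = \<mu> * (a \<bullet> b))"
      by (intro exI[of _ "\<lambda>a. Q (?D a)"] exI[of _ "(A (norm w))\<^sup>2"]) simp
  qed
qed

section \<open>Choice of the frame in coordinates\<close>

theorem theorem2p1:
  fixes n j :: nat
    and c :: "nat \<Rightarrow> 'n::finite"
    and \<Gamma> :: "real \<Rightarrow> real ^ 'n"
  assumes "n \<ge> 3"
    and "bij_betw c {1..n} (UNIV :: 'n set)"
    and "j \<in> {2..n-1}"
    and "regular_embedded_C1_curve_on \<Gamma> {0<..1}"
    and "\<forall>u\<in>{0<..1}. \<Gamma> u $ c 1 = 0"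
    and "\<Gamma> ` {0<..1} \<inter> z_axis n c = {}"
    and "closure (\<Gamma> ` {0<..1}) - \<Gamma> ` {0<..1} \<subseteq> z_axis n c"
    and "\<forall>u\<in>{0<..1}. \<forall>i\<in>{1..n} - {j, n}. \<Gamma> u $ c i = 0"
  shows "conformal_to (rotation_surface n c j \<Gamma>) punctured_unit_disc"
proof -
  have jn: "1 < j" "j < n" using assms(1,3) by auto
  have c_eq: "c i = c k \<longleftrightarrow> i = k" if "i \<in> {1..n}" "k \<in> {1..n}" for i k
    by (rule inj_on_eq_iff[OF bij_betw_imp_inj_on[OF assms(2)] that])
  define J where "J = {1..n} - {1, j, n}"
  have others: "c i \<noteq> c 1" "c i \<noteq> c j" "c i \<noteq> c n" if "i \<in> J" for i
    using that c_eq[of i 1] c_eq[of i j] c_eq[of i n] jn by (simp_all add: J_def)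
  \<comment> \<open>Surjectivity of \<open>c\<close> splits a statement about all coordinates into
    the three that matter and the rest, which lets equality of vectors be compared with the
    coordinate description of the surface.\<close>
  have coords: "(\<forall>i. R i) \<longleftrightarrow> R (c 1) \<and> R (c j) \<and> R (c n) \<and> (\<forall>i\<in>J. R (c i))"
    for R :: "'n \<Rightarrow> bool"
  proof
    assume R: "R (c 1) \<and> R (c j) \<and> R (c n) \<and> (\<forall>i\<in>J. R (c i))"
    show "\<forall>i. R i"
    proof
      fix i
      have "i \<in> c ` {1..n}" using assms(2) by (simp add: bij_betw_def)
      then obtain k where "k \<in> {1..n}" "i = c k" by (elim imageE)
      then show "R i" using R by (cases "k \<in> {1, j, n}") (auto simp: J_def)
    qed
  qed simp
  obtain g where "homeomorphism {0<..1} (\<Gamma> ` {0<..1}) \<Gamma> g"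
    using assms(4) unfolding regular_embedded_C1_curve_on_def by (elim exE conjE)
  then have cont: "continuous_on {0<..1} (\<lambda>u. \<Gamma> u $ c j)"
    by (intro continuous_intros) (simp add: homeomorphism_def)
  \<comment> \<open>Only \<open>x_j\<close> and \<open>z\<close> can be nonzero on the curve, so a
    zero of \<open>x_j\<close> would put a point on the axis.\<close>
  have nonzero: "\<Gamma> u $ c j \<noteq> 0" if u: "u \<in> {0<..1}" for u
  proof
    assume "\<Gamma> u $ c j = 0"
    then have "\<Gamma> u \<in> z_axis n c"
      unfolding z_axis_def using bspec[OF assms(8) u] jn by (fastforce simp: Ball_def)
    then show False using assms(6) u by blast
  qed
  \<comment> \<open>\<open>x\<^sub>j\<close> may be negative on \<open>\<Gamma>\<close>; a half turn, which preserves the surface, makes it positive.\<close>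
  define \<sigma> where "\<sigma> = sgn (\<Gamma> 1 $ c j)"
  have \<sigma>: "\<sigma> * \<sigma> = 1" using nonzero[of 1] by (simp add: \<sigma>_def sgn_if)
  \<comment> \<open>A change of sign between \<open>u\<close> and 1 would force a zero of
    \<open>x_j\<close> by the intermediate value theorem.\<close>
  have pos: "\<sigma> * (\<Gamma> u $ c j) > 0" if u: "u \<in> {0<..1}" for u
  proof (rule ccontr)
    assume neg: "\<not> \<sigma> * (\<Gamma> u $ c j) > 0"
    have "continuous_on {u..1} (\<lambda>v. \<sigma> * (\<Gamma> v $ c j))"
      using u by (intro continuous_on_mult continuous_on_const continuous_on_subset[OF cont]) auto
    moreover have "0 \<le> \<sigma> * (\<Gamma> 1 $ c j)" by (simp add: \<sigma>_def sgn_if)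
    ultimately have "\<exists>v. u \<le> v \<and> v \<le> 1 \<and> \<sigma> * (\<Gamma> v $ c j) = 0"
      using neg u by (intro IVT') auto
    then obtain v where v: "u \<le> v" "v \<le> 1" "\<sigma> * (\<Gamma> v $ c j) = 0" by (elim exE conjE)
    moreover have "\<sigma> \<noteq> 0" using \<sigma> by auto
    ultimately show False using nonzero[of v] u by simp
  qed
  \<comment> \<open>Both horizontal vectors carry \<open>\<sigma>\<close>, so it occurs twice in
    each horizontal coordinate of a rotated point and cancels by
    \<open>\<sigma> * \<sigma> = 1\<close>. The cosine belongs to \<open>x_j\<close> and the sine to
    \<open>x_1\<close>, hence \<open>e1\<close> lies along \<open>x_j\<close>.\<close>
  define e1 e2 e3 :: "real ^ 'n"
    where "e1 = \<sigma> *\<^sub>R axis (c j) 1" and "e2 = \<sigma> *\<^sub>R axis (c 1) 1" and "e3 = axis (c n) 1"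
  have ne: "c j \<noteq> c 1" "c n \<noteq> c 1" "c n \<noteq> c j"
    using c_eq[of j 1] c_eq[of n 1] c_eq[of n j] jn by simp_all
  have inner: "x \<bullet> e1 = \<sigma> * x $ c j" "x \<bullet> e2 = \<sigma> * x $ c 1" "x \<bullet> e3 = x $ c n" for x
    by (simp_all add: e1_def e2_def e3_def inner_axis)
  have nth: "e1 $ i = (if i = c j then \<sigma> else 0)" "e2 $ i = (if i = c 1 then \<sigma> else 0)"
    "e3 $ i = (if i = c n then 1 else 0)" for i
    by (auto simp: e1_def e2_def e3_def axis_def)
  have V: "rotation_surface n c j \<Gamma> = {x. \<exists>u\<in>{0<..<1}. \<exists>\<zeta>. norm \<zeta> = 1 \<and>
      x = (\<Gamma> u \<bullet> e1) *\<^sub>R (Re \<zeta> *\<^sub>R e1 + Im \<zeta> *\<^sub>R e2) + (\<Gamma> u \<bullet> e3) *\<^sub>R e3}" (is "_ = ?V")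
  proof -
    have eq: "x = (\<Gamma> u \<bullet> e1) *\<^sub>R (Re \<zeta> *\<^sub>R e1 + Im \<zeta> *\<^sub>R e2) + (\<Gamma> u \<bullet> e3) *\<^sub>R e3 \<longleftrightarrow>
        x $ c 1 = \<Gamma> u $ c j * Im \<zeta> \<and> x $ c j = \<Gamma> u $ c j * Re \<zeta> \<and> x $ c n = \<Gamma> u $ c n \<and>
        (\<forall>i\<in>J. x $ c i = 0)" for x u \<zeta>
    proof -
      have \<sigma>': "\<sigma> * (a * (b * \<sigma>)) = a * b" for a b using \<sigma> by (simp add: mult.commute mult.left_commute)
      show ?thesis
        unfolding vec_eq_iff coords
        using ne ne[symmetric] others by (simp add: nth inner \<sigma>' mult.assoc cong: ball_cong)
    qed
    \<comment> \<open>Angles in \<open>{0..<2*pi}\<close> correspond to unit complex numbers through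
      \<open>cis\<close>; an arbitrary predicate \<open>R\<close> lets the exchange take place under
      the quantifiers over points and parameters.\<close>
    have "(\<exists>\<theta>\<in>{0..<2*pi}. R (sin \<theta>) (cos \<theta>)) \<longleftrightarrow> (\<exists>\<zeta>. norm \<zeta> = 1 \<and> R (Im \<zeta>) (Re \<zeta>))"
      for R :: "real \<Rightarrow> real \<Rightarrow> bool"
    proof
      assume "\<exists>\<theta>\<in>{0..<2*pi}. R (sin \<theta>) (cos \<theta>)"
      then obtain \<theta> where "R (sin \<theta>) (cos \<theta>)" by (elim bexE)
      then show "\<exists>\<zeta>. norm \<zeta> = 1 \<and> R (Im \<zeta>) (Re \<zeta>)" by (intro exI[of _ "cis \<theta>"]) simp
    next
      assume "\<exists>\<zeta>. norm \<zeta> = 1 \<and> R (Im \<zeta>) (Re \<zeta>)"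
      then obtain \<zeta> where \<zeta>: "norm \<zeta> = 1" "R (Im \<zeta>) (Re \<zeta>)" by (elim exE conjE)
      have "(Re \<zeta>)\<^sup>2 + (Im \<zeta>)\<^sup>2 = 1" using \<zeta>(1) cmod_power2[of \<zeta>] by simp
      then obtain t where "0 \<le> t" "t < 2 * pi" "Re \<zeta> = cos t" "Im \<zeta> = sin t"
        by (rule sincos_total_2pi)
      then show "\<exists>\<theta>\<in>{0..<2*pi}. R (sin \<theta>) (cos \<theta>)" using \<zeta>(2) by (intro bexI[of _ t]) simp_all
    qed
    note this[of "\<lambda>a b. x $ c 1 = \<Gamma> u $ c j * a \<and> x $ c j = \<Gamma> u $ c j * b \<and> x $ c n = \<Gamma> u $ c n \<and>
        (\<forall>i\<in>J. x $ c i = 0)" for x u]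
    then show ?thesis unfolding rotation_surface_def eq J_def[symmetric] by simp
  qed
  show ?thesis
    unfolding V
  proof (rule conformal_surface_of_revolution[OF _ _ _ _ _ _ assms(4)])
    show "e1 \<bullet> e1 = 1" "e2 \<bullet> e2 = 1" "e3 \<bullet> e3 = 1" "e1 \<bullet> e2 = 0" "e1 \<bullet> e3 = 0" "e2 \<bullet> e3 = 0"
      using ne ne[symmetric] \<sigma> by (simp_all only: inner nth if_True if_False mult_zero_right simp_thms)
    show "\<Gamma> u \<bullet> e1 > 0" if "u \<in> {0<..1}" for u using pos[OF that] by (simp add: inner)
    show "\<Gamma> u = (\<Gamma> u \<bullet> e1) *\<^sub>R e1 + (\<Gamma> u \<bullet> e3) *\<^sub>R e3" if u: "u \<in> {0<..1}" for u
    proof -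
      have zero: "\<Gamma> u $ c i = 0" if "i \<in> J" for i using assms(8) u that by (simp add: J_def)
      have \<sigma>': "\<sigma> * a * \<sigma> = a" for a using \<sigma> by (simp add: mult.commute mult.left_commute)
      show ?thesis
        unfolding vec_eq_iff coords
        using ne ne[symmetric] others zero assms(5) u by (simp add: nth inner \<sigma>' cong: ball_cong)
    qed
    show "p \<bullet> e1 = 0" if "p \<in> closure (\<Gamma> ` {0<..1}) - \<Gamma> ` {0<..1}" for p
      using subsetD[OF assms(7) that] jn by (auto simp: z_axis_def inner)
  qed
qed

end
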